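(* Let $\lambda>0$, $T>0$, and let $0<\sigma_1<\bar\sigma<\sigma_2$ satisfy $(\sigma_1+\sigma_2)/2=\bar\sigma$. Let $A\in\mathbb R^{n\times n}$ be Hurwitz and Metzler, and let $b,c\in\mathbb R^n_+$ be vectors with nonnegative entries. Consider the cascade $$\dot x=\sigma(t)(1-x)-\lambda x,\qquad w=\lambda x,\qquad \dot z=Az+bw,\qquad y=c^Tz.$$ Let $H(s):=c^T(sI-A)^{-1}b$. If $\sigma\in B_{\bar\sigma,T}$ (defined in the context), then $$\frac1T\int_0^T y_\sigma(t)\,dt\ \le\ \frac{\lambda\bar\sigma}{\lambda+\bar\sigma}\,H(0).$$
   Context: A real square matrix is Hurwitz if all its eigenvalues have negative real part, and Metzler if all its off-diagonal entries are nonnegative. For a bounded measurable $T$-periodic inflow $\sigma:[0,\infty)\to(0,\infty)$, all trajectories of the cascade with $x(0)\in[0,1]$ (solutions understood as absolutely continuous functions satisfying the equations for almost every $t$) converge to a unique $T$-periodic trajectory $(x_\sigma(t),z_\sigma(t))$, with $x_\sigma(t)\in[0,1]$; write $y_\sigma:=c^Tz_\sigma$. The set of admissible inflows $B_{\bar\sigma,T}$ is the set of all measurable functions $\sigma:[0,\infty)\to\{\sigma_1,\bar\sigma,\sigma_2\}$ such that $\sigma(t+T)=\sigma(t)$ for all $t\ge 0$, $\frac1T\int_0^T\sigma(t)\,dt=\bar\sigma$, and, for every $t$, $\sigma(t)=\bar\sigma$ implies $x_\sigma(t)=\bar\sigma/(\lambda+\bar\sigma)$. *)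

theory Defs
  imports "HOL-Analysis.Analysis"
begin

definition complex_matrix :: "real^'n^'m \<Rightarrow> complex^'n^'m" where
  "complex_matrix A = (\<chi> i j. complex_of_real (A $ i $ j))"

definition hurwitz :: "real^'n^'n \<Rightarrow> bool" where
  "hurwitz A \<longleftrightarrow>
     (\<forall>\<mu> v. v \<noteq> 0 \<and> complex_matrix A *v v = \<mu> *s v \<longrightarrow> Re \<mu> < 0)"

definition metzler :: "real^'n^'n \<Rightarrow> bool" where
  "metzler A \<longleftrightarrow> (\<forall>i j. i \<noteq> j \<longrightarrow> 0 \<le> A $ i $ j)"

(* H(s) = c^T (s I - A)^{-1} b for real s; here "mat s" is s times the identity matrix. *)
definition transfer_function ::
    "real^'n^'n \<Rightarrow> real^'n \<Rightarrow> real^'n \<Rightarrow> real \<Rightarrow> real" where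
  "transfer_function A b c s = c \<bullet> (matrix_inv (mat s - A) *v b)"

(* The epsilon-delta definition. A "division" of a set is a finite family of nonempty
   compact intervals with pairwise disjoint interiors and the set as union; Inf k and Sup k
   are the endpoints of the interval k. *)
definition absolutely_continuous_on :: "real \<Rightarrow> real \<Rightarrow> (real \<Rightarrow> 'a::metric_space) \<Rightarrow> bool" where
  "absolutely_continuous_on a b f \<longleftrightarrow>
     (\<forall>\<epsilon>>0. \<exists>\<delta>>0. \<forall>D S. D division_of S \<and> S \<subseteq> {a..b} \<and> (\<Sum>k\<in>D. Sup k - Inf k) < \<delta>
        \<longrightarrow> (\<Sum>k\<in>D. dist (f (Inf k)) (f (Sup k))) < \<epsilon>)"

(* Functions on [0,\<infinity>) are represented by total functions on the reals whose values
   at negative arguments are irrelevant. *)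
definition caratheodory_solution ::
    "(real \<Rightarrow> 'a \<Rightarrow> 'a) \<Rightarrow> (real \<Rightarrow> 'a::real_normed_vector) \<Rightarrow> bool" where
  "caratheodory_solution F u \<longleftrightarrow>
     (\<forall>r\<ge>0. absolutely_continuous_on 0 r u) \<and>
     (AE t in lebesgue_on {0..}. (u has_vector_derivative F t (u t)) (at t within {0..}))"

definition periodic_from_0 :: "real \<Rightarrow> (real \<Rightarrow> 'a) \<Rightarrow> bool" where
  "periodic_from_0 T u \<longleftrightarrow> (\<forall>t\<ge>0. u (t + T) = u t)"

definition x_trajectory :: "real \<Rightarrow> (real \<Rightarrow> real) \<Rightarrow> (real \<Rightarrow> real) \<Rightarrow> bool" where
  "x_trajectory lam \<sigma> x \<longleftrightarrow>
     x 0 \<in> {0..1} \<and> caratheodory_solution (\<lambda>t u. \<sigma> t * (1 - u) - lam * u) x"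

definition z_trajectory ::
    "real \<Rightarrow> real^'n^'n \<Rightarrow> real^'n \<Rightarrow> (real \<Rightarrow> real) \<Rightarrow> (real \<Rightarrow> real^'n) \<Rightarrow> bool" where
  "z_trajectory lam A b x z \<longleftrightarrow>
     caratheodory_solution (\<lambda>t u. A *v u + (lam * x t) *\<^sub>R b) z"

(* For a bounded measurable positive T-periodic inflow there is, on [0,\<infinity>), exactly one
   x satisfying "periodic_x lam T \<sigma> x", and for Hurwitz A exactly one pair (x, z) satisfying
   "periodic_trajectory lam T A b \<sigma> x z", namely (x_\<sigma>, z_\<sigma>). *)
definition periodic_x :: "real \<Rightarrow> real \<Rightarrow> (real \<Rightarrow> real) \<Rightarrow> (real \<Rightarrow> real) \<Rightarrow> bool" where
  "periodic_x lam T \<sigma> x \<longleftrightarrow> x_trajectory lam \<sigma> x \<and> periodic_from_0 T x"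

definition periodic_trajectory ::
    "real \<Rightarrow> real \<Rightarrow> real^'n^'n \<Rightarrow> real^'n \<Rightarrow> (real \<Rightarrow> real) \<Rightarrow>
     (real \<Rightarrow> real) \<Rightarrow> (real \<Rightarrow> real^'n) \<Rightarrow> bool" where
  "periodic_trajectory lam T A b \<sigma> x z \<longleftrightarrow>
     periodic_x lam T \<sigma> x \<and> z_trajectory lam A b x z \<and> periodic_from_0 T z"

definition admissible_inflows ::
    "real \<Rightarrow> real \<Rightarrow> real \<Rightarrow> real \<Rightarrow> real \<Rightarrow> (real \<Rightarrow> real) set" where
  "admissible_inflows lam T \<sigma>1 \<sigma>bar \<sigma>2 =
     {\<sigma>. \<sigma> \<in> borel_measurable (lebesgue_on {0..}) \<and>
          (\<forall>t\<ge>0. \<sigma> t \<in> {\<sigma>1, \<sigma>bar, \<sigma>2}) \<and>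
          periodic_from_0 T \<sigma> \<and>
          (1 / T) * integral {0..T} \<sigma> = \<sigma>bar \<and>
          (\<forall>x. periodic_x lam T \<sigma> x \<longrightarrow>
             (\<forall>t\<ge>0. \<sigma> t = \<sigma>bar \<longrightarrow> x t = \<sigma>bar / (lam + \<sigma>bar)))}"

end

theory Submission
  imports Defs
begin

text \<open>Along a periodic solution \<open>x < 1\<close>, and \<open>- ln (1 - x)\<close> has derivative
  \<open>\<sigma> - lam * x / (1 - x)\<close>, so \<open>lam * x / (1 - x)\<close> has mean \<open>\<sigma>bar\<close>. Since
  \<open>y / (1 - y)\<close> is convex, the mean of \<open>x\<close> is at most \<open>\<sigma>bar / (lam + \<sigma>bar)\<close>.
  Averaging the linear equation over a period multiplies the mean of \<open>lam * x\<close> by \<open>H 0\<close>, which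
  is nonnegative because \<open>- A\<close> is a nonsingular M-matrix.\<close>

subsection \<open>Absolutely continuous functions\<close>

text \<open>Outer regularity of Lebesgue measure. The open set later serves as the gauge at tags in
  the exceptional null set.\<close>

lemma negligible_outer_open:
  fixes N :: "'a::euclidean_space set"
  assumes "negligible N" and "0 < e"
  obtains U where "open U" "N \<subseteq> U" "U \<in> lmeasurable" "measure lebesgue U < e"
proof -
  have N: "N \<in> lmeasurable" "measure lebesgue N = 0"
    using assms(1) by (simp_all add: negligible_imp_measurable negligible_imp_measure0)
  obtain U where U: "open U" "N \<subseteq> U" "U - N \<in> lmeasurable"
      "emeasure lebesgue (U - N) < ennreal e"
    using sets_lebesgue_outer_open[of N e] N assms(2) by blast
  have eq: "U = (U - N) \<union> N"
    using U(2) by blast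
  have "measure lebesgue U \<le> measure lebesgue (U - N) + measure lebesgue N"
    by (subst eq) (intro measure_Un_le fmeasurableD U(3) N(1))
  also have "\<dots> < e"
    using U(3,4) N(2) by (simp add: emeasure_eq_measure2 ennreal_less_iff)
  finally have "measure lebesgue U < e" .
  moreover have "U \<in> lmeasurable"
    using U(3) N(1) fmeasurable.Un eq by metis
  ultimately show thesis
    using U that by blast
qed

text \<open>Meant for \<open>- ln (1 - x t)\<close> with \<open>1 - x t\<close> bounded away from 0:
  a Lipschitz map enlarges each increment by at most the factor \<open>L\<close>.\<close>

lemma absolutely_continuous_on_Lipschitz_compose:
  assumes "absolutely_continuous_on a b f" and "L-lipschitz_on (f ` {a..b}) g"
  shows "absolutely_continuous_on a b (\<lambda>t. g (f t))"
  unfolding absolutely_continuous_on_def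
proof (intro allI impI)
  fix e :: real assume "0 < e"
  have L: "0 \<le> L" using assms(2) by (rule lipschitz_on_nonneg)
  \<comment> \<open>Using \<open>L + 1\<close> instead of \<open>L\<close> admits
    \<open>L = 0\<close> and makes the final estimate strict.\<close>
  then have "0 < e / (L + 1)" using \<open>0 < e\<close> by simp
  then obtain d where "0 < d" and d: "\<And>D S. D division_of S \<Longrightarrow> S \<subseteq> {a..b} \<Longrightarrow>
      (\<Sum>k\<in>D. Sup k - Inf k) < d \<Longrightarrow> (\<Sum>k\<in>D. dist (f (Inf k)) (f (Sup k))) < e / (L + 1)"
    using assms(1)[unfolded absolutely_continuous_on_def, rule_format, OF \<open>0 < e / (L + 1)\<close>]
    by blast
  show "\<exists>d>0. \<forall>D S. D division_of S \<and> S \<subseteq> {a..b} \<and> (\<Sum>k\<in>D. Sup k - Inf k) < d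
      \<longrightarrow> (\<Sum>k\<in>D. dist (g (f (Inf k))) (g (f (Sup k)))) < e"
  proof (intro exI[of _ d] conjI allI impI \<open>0 < d\<close>)
    fix D S assume "D division_of S \<and> S \<subseteq> {a..b} \<and> (\<Sum>k\<in>D. Sup k - Inf k) < d"
    then have D: "D division_of S" "S \<subseteq> {a..b}" "(\<Sum>k\<in>D. Sup k - Inf k) < d"
      by auto
    have "dist (g (f (Inf k))) (g (f (Sup k))) \<le> L * dist (f (Inf k)) (f (Sup k))" if kD: "k \<in> D" for k
    proof -
      obtain u v where k: "k = cbox u v" "k \<noteq> {}"
        using division_ofD(3,4)[OF D(1) kD] by blast
      then have "u \<in> k" "v \<in> k" "Inf k = u" "Sup k = v"
        by auto
      then have "Inf k \<in> {a..b}" "Sup k \<in> {a..b}"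
        using D(2) division_ofD(2)[OF D(1) kD] by blast+
      then show ?thesis
        using assms(2) by (auto intro: lipschitz_onD)
    qed
    then have "(\<Sum>k\<in>D. dist (g (f (Inf k))) (g (f (Sup k)))) \<le> (\<Sum>k\<in>D. L * dist (f (Inf k)) (f (Sup k)))"
      by (rule sum_mono)
    also have "\<dots> \<le> L * (e / (L + 1))"
      unfolding sum_distrib_left[symmetric]
      using d[OF D] L by (intro mult_left_mono) auto
    also have "\<dots> < e"
      using L \<open>0 < e\<close> by (simp add: field_simps)
    finally show "(\<Sum>k\<in>D. dist (g (f (Inf k))) (g (f (Sup k)))) < e" .
  qed
qed

lemma absolutely_continuous_on_subinterval:
  assumes "absolutely_continuous_on a b f" "a \<le> c" "d \<le> b"
  shows "absolutely_continuous_on c d f"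
proof -
  have "{c..d} \<subseteq> {a..b}" using assms by auto
  then show ?thesis
    using assms(1) unfolding absolutely_continuous_on_def by (meson subset_trans)
qed

lemma absolutely_continuous_on_imp_continuous_on:
  fixes f :: "real \<Rightarrow> 'a::metric_space"
  assumes "absolutely_continuous_on a b f"
  shows "continuous_on {a..b} f"
  unfolding continuous_on_iff
proof (intro ballI allI impI)
  fix s and e :: real assume s: "s \<in> {a..b}" and "0 < e"
  then obtain d where "0 < d" and d: "\<And>D S. D division_of S \<Longrightarrow> S \<subseteq> {a..b} \<Longrightarrow>
      (\<Sum>k\<in>D. Sup k - Inf k) < d \<Longrightarrow> (\<Sum>k\<in>D. dist (f (Inf k)) (f (Sup k))) < e"
    using assms unfolding absolutely_continuous_on_def by metis
  \<comment> \<open>A single interval is a division of itself, so absolute continuity already bounds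
    one increment.\<close>
  have close: "dist (f u) (f v) < e" if "u \<le> v" "v - u < d" "u \<in> {a..b}" "v \<in> {a..b}" for u v
    using d[OF division_of_self[of u v]] that by auto
  show "\<exists>d>0. \<forall>t\<in>{a..b}. dist t s < d \<longrightarrow> dist (f t) (f s) < e"
  proof (intro exI conjI ballI impI, rule \<open>0 < d\<close>)
    fix t assume "t \<in> {a..b}" "dist t s < d"
    then show "dist (f t) (f s) < e"
      using close[of s t] close[of t s] s by (cases "s \<le> t") (auto simp: dist_commute dist_real_def)
  qed
qed

text \<open>Tagged intervals whose tag lies in the exceptional null set are forced by the gauge into an
  open set of small measure, so that absolute continuity controls the increments over them.\<close>

theorem absolutely_continuous_on_has_integral:
  fixes f :: "real \<Rightarrow> 'a::real_normed_vector"
  assumes "a \<le> b" and ac: "absolutely_continuous_on a b f" and N: "negligible N"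
    and deriv: "\<And>t. t \<in> {a..b} - N \<Longrightarrow> (f has_vector_derivative f' t) (at t within {a..b})"
  shows "(f' has_integral (f b - f a)) {a..b}"
proof (rule has_integral_spike[OF N])
  \<comment> \<open>With value 0 at tags in \<open>N\<close>, the error term of such a tag is the
    bare increment of \<open>f\<close>.\<close>
  define g where "g t = (if t \<in> N then 0 else f' t)" for t
  show "f' t = g t" if "t \<in> {a..b} - N" for t
    using that by (simp add: g_def)
  show "(g has_integral (f b - f a)) {a..b}"
    unfolding has_integral_real
  proof (intro allI impI)
    fix e :: real assume "0 < e"
    \<comment> \<open>Half of \<open>e\<close> is reserved for the tags outside \<open>N\<close>;
      the summand 1 allows \<open>a = b\<close>.\<close>
    define e1 where "e1 = e / (2 * (b - a + 1))"
    have "0 < e1" using \<open>0 < e\<close> assms(1) by (simp add: e1_def)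
    have e1: "e1 * (b - a) < e / 2"
      using \<open>0 < e\<close> assms(1) by (simp add: e1_def field_simps)
    have "\<forall>x. \<exists>d>0. x \<in> {a..b} - N \<longrightarrow>
        (\<forall>y\<in>{a..b}. norm (y - x) < d \<longrightarrow> norm (f y - f x - (y - x) *\<^sub>R f' x) \<le> e1 * norm (y - x))"
      using deriv[unfolded has_vector_derivative_def has_derivative_within_alt] \<open>0 < e1\<close>
      by (meson zero_less_one)
    then obtain d where d: "\<And>x. 0 < d x"
        "\<And>x y. \<lbrakk>x \<in> {a..b} - N; y \<in> {a..b}; norm (y - x) < d x\<rbrakk>
          \<Longrightarrow> norm (f y - f x - (y - x) *\<^sub>R f' x) \<le> e1 * norm (y - x)"
      by metis
    obtain \<delta> where "0 < \<delta>" and \<delta>: "\<And>D S. D division_of S \<Longrightarrow> S \<subseteq> {a..b} \<Longrightarrow>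
        (\<Sum>k\<in>D. Sup k - Inf k) < \<delta> \<Longrightarrow> (\<Sum>k\<in>D. dist (f (Inf k)) (f (Sup k))) < e / 2"
      using ac \<open>0 < e\<close> unfolding absolutely_continuous_on_def by (metis half_gt_zero)
    obtain U where U: "open U" "N \<subseteq> U" "U \<in> lmeasurable" "measure lebesgue U < \<delta>"
      using negligible_outer_open[OF N \<open>0 < \<delta>\<close>] .
    define \<gamma> where "\<gamma> x = (if x \<in> N then U else ball x (d x))" for x
    have "gauge \<gamma>"
      using U d(1) by (auto simp: gauge_def \<gamma>_def)
    have close: "norm ((\<Sum>(x, k)\<in>p. measure lborel k *\<^sub>R g x) - (f b - f a)) < e"
      if p: "p tagged_division_of {a..b}" and fine: "\<gamma> fine p" for p
    proof -
      let ?h = "\<lambda>(x, k). measure lborel k *\<^sub>R g x - (f (Sup k) - f (Inf k))"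
      have "finite p" using p by blast
      have interval: "\<exists>u v. k = {u..v} \<and> u \<le> x \<and> x \<le> v \<and> a \<le> u \<and> v \<le> b \<and> Inf k = u \<and> Sup k = v"
        if xk: "(x, k) \<in> p" for x k
      proof -
        obtain u v where "k = cbox u v" "x \<in> k" "k \<subseteq> {a..b}"
          using tagged_division_ofD(2,3,4)[OF p xk] by blast
        then show ?thesis by force
      qed
      define q where "q = {(x, k) \<in> p. x \<in> N}"
      have "q \<subseteq> p"
        by (auto simp: q_def)
      then have "finite q"
        using \<open>finite p\<close> by (rule finite_subset)
      \<comment> \<open>Straddle estimate: the tag lies between the endpoints, so the two
        linearization errors add up to at most \<open>e1\<close> times the length.\<close>
      have good: "norm (?h xk) \<le> e1 * (\<lambda>(x, k). Sup k - Inf k) xk" if "xk \<in> p - q" for xk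
      proof -
        obtain x k where xk: "xk = (x, k)" by (cases xk)
        have "(x, k) \<in> p" "x \<notin> N" using that by (auto simp: xk q_def)
        then obtain u v where k: "k = {u..v}" "u \<le> x" "x \<le> v" "a \<le> u" "v \<le> b" "Inf k = u" "Sup k = v"
          using interval by blast
        have "k \<subseteq> ball x (d x)"
          using fine \<open>(x, k) \<in> p\<close> \<open>x \<notin> N\<close> fineD by (fastforce simp: \<gamma>_def)
        moreover have "u \<in> k" "v \<in> k" using k by auto
        ultimately have "u \<in> ball x (d x)" "v \<in> ball x (d x)" by blast+
        then have "norm (u - x) < d x" "norm (v - x) < d x"
          by (auto simp: dist_real_def)
        then have uv: "norm (f u - f x - (u - x) *\<^sub>R f' x) \<le> e1 * norm (u - x)"
            "norm (f v - f x - (v - x) *\<^sub>R f' x) \<le> e1 * norm (v - x)"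
          using d(2)[of x u] d(2)[of x v] \<open>x \<notin> N\<close> k by auto
        have "(v - u) *\<^sub>R f' x - (f v - f u)
            = (f u - f x - (u - x) *\<^sub>R f' x) - (f v - f x - (v - x) *\<^sub>R f' x)"
          by (simp add: algebra_simps)
        also have "norm \<dots> \<le> e1 * norm (u - x) + e1 * norm (v - x)"
          by (rule order_trans[OF norm_triangle_ineq4 add_mono[OF uv]])
        also have "\<dots> = e1 * (v - u)"
          using k by (simp add: algebra_simps)
        finally show ?thesis
          using k \<open>x \<notin> N\<close> by (simp add: xk g_def)
      qed
      have tp: "q tagged_partial_division_of {a..b}"
        using tagged_partial_division_subset[OF _ \<open>q \<subseteq> p\<close>] p
        by (simp add: tagged_division_of_def)
      let ?D = "snd ` q"
      have D: "?D division_of \<Union>?D"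
        using tp by (rule partial_division_of_tagged_division)
      have D_sub: "\<Union>?D \<subseteq> {a..b}"
        using tagged_partial_division_ofD(3)[OF tp] by force
      \<comment> \<open>The intervals do not overlap, so their total length is the measure of their
        union, which the gauge keeps inside \<open>U\<close>.\<close>
      have "(\<Sum>k\<in>?D. Sup k - Inf k) = (\<Sum>k\<in>?D. measure lebesgue k)"
      proof (rule sum.cong[OF refl])
        fix k assume "k \<in> ?D"
        then obtain x where "(x, k) \<in> p" using \<open>q \<subseteq> p\<close> by force
        then obtain u v where k: "k = {u..v}" "u \<le> v" "Inf k = u" "Sup k = v"
          using interval order_trans by blast
        show "Sup k - Inf k = measure lebesgue k"
          unfolding k(3,4) using k(1,2) by simp
      qed
      also have "\<dots> = measure lebesgue (\<Union>?D)"
        using D by (rule content_division)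
      also have "\<dots> \<le> measure lebesgue U"
      proof (rule measure_mono_fmeasurable)
        show "\<Union>?D \<subseteq> U"
        proof (rule Union_least)
          fix k assume "k \<in> ?D"
          then obtain x where "(x, k) \<in> p" "x \<in> N" by (auto simp: q_def)
          then show "k \<subseteq> U" using fineD[OF fine, of x k] by (simp add: \<gamma>_def)
        qed
        show "\<Union>?D \<in> sets lebesgue"
          using lmeasurable_division[OF D] by blast
      qed (rule U(3))
      finally have "(\<Sum>k\<in>?D. Sup k - Inf k) < \<delta>"
        using U(4) by simp
      with D D_sub have small: "(\<Sum>k\<in>?D. dist (f (Inf k)) (f (Sup k))) < e / 2"
        by (rule \<delta>)
      have "(\<Sum>k\<in>?D. dist (f (Inf k)) (f (Sup k)))
          = (\<Sum>xk\<in>q. dist (f (Inf (snd xk))) (f (Sup (snd xk))))"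
      proof (subst sum.reindex_nontrivial[OF \<open>finite q\<close>])
        fix y y' assume y: "y \<in> q" "y' \<in> q" "y \<noteq> y'" "snd y = snd y'"
        obtain x k x' where yy: "y = (x, k)" "y' = (x', k)"
          using y(4) by (metis prod.collapse)
        have "(x, k) \<in> p" using y(1) \<open>q \<subseteq> p\<close> yy by blast
        then obtain u v where k: "k = {u..v}" "u \<le> v" "Inf k = u" "Sup k = v"
          using interval order_trans by blast
        \<comment> \<open>Pairs with different tags have disjoint interiors, so an interval shared
          by two tags is degenerate and its increment is 0.\<close>
        have "interior k = {}"
          using tagged_partial_division_ofD(5)[OF tp, of x k x' k] y yy by auto
        then have "u = v"
          using k(1,2) by simp
        then show "dist (f (Inf (snd y))) (f (Sup (snd y))) = 0"
          using k(3,4) yy by simp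
      qed simp
      moreover have "norm (?h xk) = dist (f (Inf (snd xk))) (f (Sup (snd xk)))" if "xk \<in> q" for xk
        using that by (auto simp: q_def g_def dist_norm)
      ultimately have bad: "(\<Sum>xk\<in>q. norm (?h xk)) < e / 2"
        using small by simp
      \<comment> \<open>The increments of \<open>f\<close> over the division telescope to
        \<open>f b - f a\<close>.\<close>
      have "(\<Sum>(x, k)\<in>p. measure lborel k *\<^sub>R g x) - (f b - f a) = (\<Sum>xk\<in>p. ?h xk)"
        unfolding additive_tagged_division_1[OF assms(1) p, of f, symmetric]
        by (simp add: sum_subtractf[symmetric] split_def)
      also have "norm \<dots> \<le> (\<Sum>xk\<in>p. norm (?h xk))"
        by (rule norm_sum)
      also have "\<dots> = (\<Sum>xk\<in>p - q. norm (?h xk)) + (\<Sum>xk\<in>q. norm (?h xk))"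
        using \<open>finite p\<close> \<open>q \<subseteq> p\<close> by (rule sum.subset_diff[rotated])
      also have "(\<Sum>xk\<in>p - q. norm (?h xk)) \<le> (\<Sum>xk\<in>p - q. e1 * (\<lambda>(x, k). Sup k - Inf k) xk)"
        using good by (rule sum_mono)
      also have "\<dots> \<le> (\<Sum>xk\<in>p. e1 * (\<lambda>(x, k). Sup k - Inf k) xk)"
      proof (rule sum_mono2)
        fix xk assume "xk \<in> p - (p - q)"
        then show "0 \<le> e1 * (\<lambda>(x, k). Sup k - Inf k) xk"
          using \<open>0 < e1\<close> interval[of "fst xk" "snd xk"] by (auto simp: split_def)
      qed (use \<open>finite p\<close> in auto)
      also have "\<dots> = e1 * (b - a)"
        using additive_tagged_division_1[OF assms(1) p, of "\<lambda>x. x"] by (simp add: sum_distrib_left[symmetric])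
      finally show ?thesis
        using e1 bad by linarith
    qed
    show "\<exists>\<gamma>. gauge \<gamma> \<and> (\<forall>p. p tagged_division_of {a..b} \<and> \<gamma> fine p \<longrightarrow>
        norm ((\<Sum>(x, k)\<in>p. measure lborel k *\<^sub>R g x) - (f b - f a)) < e)"
      using \<open>gauge \<gamma>\<close> close by (intro exI[of _ \<gamma>] conjI allI impI) simp_all
  qed
qed

subsection \<open>Hurwitz Metzler matrices\<close>

lemma matrix_inv_solves:
  fixes M :: "real^'n^'n"
  assumes "invertible M"
  shows "M *v w = b \<longleftrightarrow> w = matrix_inv M *v b"
proof -
  have "M ** matrix_inv M = mat 1 \<and> matrix_inv M ** M = mat 1"
    using assms unfolding invertible_def matrix_inv_def by (rule someI_ex)
  then show ?thesis
    by (metis matrix_vector_mul_assoc matrix_vector_mul_lid)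
qed

lemma mat_diff_mult_component:
  "((mat s - A) *v w) $ i = s * w $ i - (\<Sum>j\<in>UNIV. A $ i $ j * w $ j)" for A :: "real^'n^'n"
proof -
  have "(\<Sum>j\<in>UNIV. mat s $ i $ j * w $ j) = (\<Sum>j\<in>UNIV. if j = i then s * w $ j else 0)"
    by (intro sum.cong) (auto simp: mat_def)
  then show ?thesis
    by (simp add: matrix_vector_mult_def left_diff_distrib sum_subtractf)
qed

text \<open>A nonzero kernel vector, read as a complex vector, would be an eigenvector of
  \<open>A\<close> for the eigenvalue \<open>s\<close>, whose real part is not negative.\<close>

lemma hurwitz_imp_invertible:
  fixes A :: "real^'n^'n"
  assumes "hurwitz A" and "0 \<le> s"
  shows "invertible (mat s - A)"
proof -
  have "v = 0" if v: "(mat s - A) *v v = 0" for v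
  proof (rule ccontr)
    assume "v \<noteq> 0"
    define w where "w = (\<chi> i. complex_of_real (v $ i))"
    have "(\<Sum>j\<in>UNIV. A $ i $ j * v $ j) = s * v $ i" for i
      using v mat_diff_mult_component[of s A v i] by simp
    then have "complex_matrix A *v w = complex_of_real s *s w"
      by (simp add: vec_eq_iff matrix_vector_mult_def complex_matrix_def w_def
          flip: of_real_mult of_real_sum)
    moreover have "w \<noteq> 0"
      using \<open>v \<noteq> 0\<close> by (simp add: w_def vec_eq_iff)
    ultimately have "Re (complex_of_real s) < 0"
      using assms(1) unfolding hurwitz_def by blast
    then show False using assms(2) by simp
  qed
  then show ?thesis
    unfolding invertible_left_inverse matrix_left_invertible_ker by blast
qed

lemma continuous_on_det:
  fixes M :: "'a::topological_space \<Rightarrow> real^'n^'n"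
  assumes "\<And>i j. continuous_on S (\<lambda>s. M s $ i $ j)"
  shows "continuous_on S (\<lambda>s. det (M s))"
  unfolding det_def by (intro continuous_intros assms)

text \<open>By Cramer's rule each component is a quotient of determinants that are continuous in
  \<open>s\<close>, with a denominator that does not vanish on \<open>{0..}\<close>.\<close>

lemma hurwitz_resolvent_continuous_on:
  fixes A :: "real^'n^'n"
  assumes "hurwitz A"
  shows "continuous_on {0..} (\<lambda>s. matrix_inv (mat s - A) *v b)"
proof -
  have det: "det (mat s - A) \<noteq> 0" if "0 \<le> s" for s
    using hurwitz_imp_invertible[OF assms that] by (simp add: invertible_det_nz)
  have resolvent: "(\<chi> k. det (\<chi> i j. if j = k then b $ i else (mat s - A) $ i $ j) / det (mat s - A))
      = matrix_inv (mat s - A) *v b" if "0 \<le> s" for s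
    by (subst matrix_inv_solves[OF hurwitz_imp_invertible[OF assms that], symmetric],
        subst cramer[OF det[OF that]], rule refl)
  have entry: "continuous_on {0..} (\<lambda>s. (mat s - A) $ i $ j)" for i j
    by (cases "i = j") (auto simp: mat_def intro!: continuous_intros)
  have "continuous_on {0..}
      (\<lambda>s. \<chi> k. det (\<chi> i j. if j = k then b $ i else (mat s - A) $ i $ j) / det (mat s - A))"
  proof (intro continuous_on_vec_lambda continuous_on_divide continuous_on_det)
    fix i j k
    show "continuous_on {0..} (\<lambda>s. (\<chi> i j. if j = k then b $ i else (mat s - A) $ i $ j) $ i $ j)"
      using entry[of i j] by (cases "j = k") auto
  qed (use det entry in auto)
  then show ?thesis
    by (rule continuous_on_eq) (simp only: resolvent atLeast_iff)
qed

text \<open>For \<open>b > 0\<close> the solution of \<open>(s I - A) w = b\<close> is positive for large \<open>s\<close> by diagonal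
  dominance, and a nonnegative solution cannot have a zero component. Hence positivity is both an
  open and a closed condition on \<open>s\<close>, and it propagates down to \<open>s = 0\<close>.\<close>

lemma hurwitz_metzler_resolvent_pos:
  fixes A :: "real^'n^'n"
  assumes "hurwitz A" "metzler A" "\<And>i. 0 < b $ i" "0 \<le> s"
  shows "0 < (matrix_inv (mat s - A) *v b) $ i"
proof -
  define w where "w s = matrix_inv (mat s - A) *v b" for s
  have eq: "s * w s $ i - (\<Sum>j\<in>UNIV. A $ i $ j * w s $ j) = b $ i" if "0 \<le> s" for s i
    using matrix_inv_solves[OF hurwitz_imp_invertible[OF assms(1) that], of "w s" b]
    by (simp add: w_def flip: mat_diff_mult_component)
  \<comment> \<open>If component \<open>i\<close> is 0, the diagonal term of row \<open>i\<close>
    drops out and the Metzler property makes the remaining sum nonnegative, forcing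
    \<open>b $ i \<le> 0\<close>.\<close>
  have strict: "0 < w s $ i" if "0 \<le> s" and nonneg: "\<And>i. 0 \<le> w s $ i" for s i
  proof (rule ccontr)
    assume "\<not> 0 < w s $ i"
    then have "w s $ i = 0" using nonneg[of i] by simp
    moreover from this have "0 \<le> (\<Sum>j\<in>UNIV. A $ i $ j * w s $ j)"
      using assms(2) nonneg unfolding metzler_def by (intro sum_nonneg) (metis mult_nonneg_nonneg mult_zero_right order_refl)
    ultimately show False
      using eq[OF that(1), of i] assms(3)[of i] by simp
  qed
  \<comment> \<open>Look at the row of a minimal component: were it negative, replacing every
    component by it would give \<open>b $ i0 \<le> 0\<close>, since the row sum is at most
    \<open>s\<close>.\<close>
  have large: "0 \<le> w s $ i" if "0 \<le> s" and s: "\<And>i. (\<Sum>j\<in>UNIV. A $ i $ j) \<le> s" for s i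
  proof -
    obtain i0 where i0: "\<And>j. w s $ i0 \<le> w s $ j"
      using ex_min_if_finite[of "range (\<lambda>j. w s $ j)"] by (auto simp: not_less)
    have "0 \<le> w s $ i0"
    proof (rule ccontr)
      assume neg: "\<not> 0 \<le> w s $ i0"
      have "(\<Sum>j\<in>UNIV. A $ i0 $ j * w s $ i0) \<le> (\<Sum>j\<in>UNIV. A $ i0 $ j * w s $ j)"
      proof (rule sum_mono)
        fix j show "A $ i0 $ j * w s $ i0 \<le> A $ i0 $ j * w s $ j"
          using assms(2) i0[of j] unfolding metzler_def
          by (cases "j = i0") (auto intro: mult_left_mono)
      qed
      then have "b $ i0 \<le> (s - (\<Sum>j\<in>UNIV. A $ i0 $ j)) * w s $ i0"
        using eq[OF that(1), of i0] by (simp add: algebra_simps sum_distrib_left sum_distrib_right)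
      also have "\<dots> \<le> 0"
        using s[of i0] neg by (intro mult_nonneg_nonpos) auto
      finally show False using assms(3)[of i0] by simp
    qed
    then show ?thesis using i0[of i] by linarith
  qed
  define P where "P = {s \<in> {0..}. \<forall>i. 0 < w s $ i}"
  have cont: "continuous_on {0..} (\<lambda>s. w s $ i)" for i
    unfolding w_def by (intro continuous_on_component hurwitz_resolvent_continuous_on assms(1))
  have "P = (\<Inter>i. {0..} \<inter> (\<lambda>s. w s $ i) -` {0<..})"
    by (auto simp: P_def)
  moreover have "openin (top_of_set {0..}) (\<Inter>i. {0..} \<inter> (\<lambda>s. w s $ i) -` {0<..})"
    by (intro openin_INT2 continuous_openin_preimage_gen cont) auto
  ultimately have "openin (top_of_set {0..}) P" by simp
  \<comment> \<open>By \<open>strict\<close>, nonnegativity and positivity of all components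
    describe the same set, so the open set \<open>P\<close> is also closed.\<close>
  moreover have "P = (\<Inter>i. {0..} \<inter> (\<lambda>s. w s $ i) -` {0..})"
    using strict by (force simp: P_def intro: less_imp_le)
  moreover have "closedin (top_of_set {0..}) (\<Inter>i. {0..} \<inter> (\<lambda>s. w s $ i) -` {0..})"
    by (intro closedin_INT continuous_closedin_preimage cont) auto
  moreover have "P \<noteq> {}"
  proof -
    \<comment> \<open>The sum of the absolute values of the row sums dominates every row sum, as
      \<open>large\<close> requires.\<close>
    define s where "s = (\<Sum>i\<in>UNIV. \<bar>\<Sum>j\<in>UNIV. A $ i $ j\<bar>)"
    have "0 \<le> s" by (simp add: s_def sum_nonneg)
    moreover have "(\<Sum>j\<in>UNIV. A $ i $ j) \<le> s" for i
      unfolding s_def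
      using member_le_sum[of i UNIV "\<lambda>i. \<bar>\<Sum>j\<in>UNIV. A $ i $ j\<bar>"] by force
    ultimately have "s \<in> P"
      using large strict by (simp add: P_def)
    then show ?thesis by blast
  qed
  moreover have "connected {0::real..}" by simp
  ultimately have "P = {0..}"
    unfolding connected_clopen by metis
  then show ?thesis
    using assms(4) by (auto simp: P_def w_def)
qed

text \<open>The resolvent is known to be positive only on strictly positive vectors, so
  \<open>b\<close> is perturbed to \<open>b + e *s 1\<close> with a small \<open>e\<close>.\<close>

lemma transfer_function_zero_nonneg:
  fixes A :: "real^'n^'n"
  assumes "hurwitz A" "metzler A" "\<forall>i. 0 \<le> b $ i" "\<forall>i. 0 \<le> c $ i"
  shows "0 \<le> transfer_function A b c 0"
proof -
  let ?R = "matrix_inv (mat 0 - A)"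
  have "0 \<le> (?R *v b) $ i" for i
  proof (rule ccontr)
    define r1 where "r1 = (?R *v 1) $ i"
    assume neg: "\<not> 0 \<le> (?R *v b) $ i"
    \<comment> \<open>Chosen so that \<open>e * (\<bar>r1\<bar> + 1)\<close> exactly cancels the
      negative component; the summand 1 avoids division by 0 and gives room for
      \<open>e * r1\<close>.\<close>
    define e where "e = - (?R *v b) $ i / (\<bar>r1\<bar> + 1)"
    have "0 < e" unfolding e_def using neg by (intro divide_pos_pos) auto
    then have "0 < (?R *v (b + e *s 1)) $ i"
      using assms by (intro hurwitz_metzler_resolvent_pos) (auto simp: add_nonneg_pos)
    then have "0 < (?R *v b) $ i + e * r1"
      by (simp add: r1_def matrix_vector_right_distrib vec.scale)
    moreover have "e * r1 \<le> e * (\<bar>r1\<bar> + 1)"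
      using \<open>0 < e\<close> by (intro mult_left_mono) auto
    moreover have "e * (\<bar>r1\<bar> + 1) = - (?R *v b) $ i"
      by (simp add: e_def)
    ultimately show False by linarith
  qed
  then show ?thesis
    using assms(4) by (auto simp: transfer_function_def inner_vec_def intro!: sum_nonneg)
qed

subsection \<open>Periodic solutions of the cascade\<close>

lemma caratheodory_solution_deriv:
  assumes "caratheodory_solution F u"
  obtains N where "negligible N"
    and "\<And>t. 0 \<le> t \<Longrightarrow> t \<notin> N \<Longrightarrow> (u has_vector_derivative F t (u t)) (at t within {0..})"
proof -
  have "AE t in lebesgue_on {0..}. (u has_vector_derivative F t (u t)) (at t within {0..})"
    using assms by (simp add: caratheodory_solution_def)
  then obtain N where N: "N \<in> null_sets (lebesgue_on {0..})"
      "\<And>t. t \<in> space (lebesgue_on {0..}) - N \<Longrightarrow> (u has_vector_derivative F t (u t)) (at t within {0..})"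
    by (rule AE_E3) blast
  have "negligible N"
    using N(1) by (simp add: null_sets_restrict_space negligible_iff_null_sets)
  with N(2) show thesis
    using that[of N] by simp
qed

text \<open>The integral form of the differential equation, from which the averages over a period
  are computed.\<close>

lemma caratheodory_solution_has_integral:
  assumes "caratheodory_solution F u" and "0 \<le> a" "a \<le> b"
  shows "((\<lambda>t. F t (u t)) has_integral (u b - u a)) {a..b}"
proof -
  obtain N where N: "negligible N"
      "\<And>t. 0 \<le> t \<Longrightarrow> t \<notin> N \<Longrightarrow> (u has_vector_derivative F t (u t)) (at t within {0..})"
    using caratheodory_solution_deriv[OF assms(1)] by metis
  show ?thesis
  proof (rule absolutely_continuous_on_has_integral[OF assms(3) _ N(1)])
    have "absolutely_continuous_on 0 b u"
      using assms by (simp add: caratheodory_solution_def)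
    then show "absolutely_continuous_on a b u"
      using assms(2) by (rule absolutely_continuous_on_subinterval) simp
    show "(u has_vector_derivative F t (u t)) (at t within {a..b})" if "t \<in> {a..b} - N" for t
      using that assms(2) by (intro has_vector_derivative_within_subset[OF N(2)]) auto
  qed
qed

lemma caratheodory_solution_continuous_on:
  assumes "caratheodory_solution F u"
  shows "continuous_on {0..r} u"
proof (cases "0 \<le> r")
  case True
  then show ?thesis
    using assms by (simp add: caratheodory_solution_def absolutely_continuous_on_imp_continuous_on)
qed simp

section \<open>The scalar equation: upper bound, logarithmic balance and mean of
  \<open>x\<close>\<close>

lemma lipschitz_on_ln:
  assumes "0 < m"
  shows "(1 / m)-lipschitz_on {m..} (ln :: real \<Rightarrow> real)"
proof (rule lipschitz_onI)
  have le: "ln u - ln v \<le> 1 / m * \<bar>u - v\<bar>" if "m \<le> u" "m \<le> v" for u v :: real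
  proof -
    have "ln u - ln v \<le> (u - v) / v"
      using that assms by (intro ln_diff_le) auto
    also have "\<dots> \<le> \<bar>u - v\<bar> / m"
      using that assms by (intro frac_le) auto
    finally show ?thesis by simp
  qed
  show "dist (ln u) (ln v) \<le> 1 / m * dist u v" if "u \<in> {m..}" "v \<in> {m..}" for u v :: real
    using le[of u v] le[of v u] that by (simp add: dist_real_def abs_minus_commute abs_le_iff)
qed (use assms in simp)

text \<open>At a maximum with value at least 1, approached from the left (after a period if it sits at 0),
  the right-hand side is at most \<open>-lam / 2\<close> nearby, so \<open>x\<close> was larger before.\<close>

lemma periodic_x_less_one:
  fixes x \<sigma> :: "real \<Rightarrow> real"
  assumes "0 < lam" "0 < T"
    and sol: "caratheodory_solution (\<lambda>t u. \<sigma> t * (1 - u) - lam * u) x"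
    and per: "x T = x 0"
    and \<sigma>: "\<And>t. 0 \<le> t \<Longrightarrow> 0 \<le> \<sigma> t \<and> \<sigma> t \<le> M"
    and t: "t \<in> {0..T}"
  shows "x t < 1"
proof (rule ccontr)
  assume "\<not> x t < 1"
  have cont: "continuous_on {0..T} x"
    using sol by (rule caratheodory_solution_continuous_on)
  obtain t1 where t1: "t1 \<in> {0..T}" "\<And>s. s \<in> {0..T} \<Longrightarrow> x s \<le> x t1"
    using continuous_attains_sup[OF _ _ cont] assms(2) by fastforce
  obtain t2 where t2: "0 < t2" "t2 \<le> T" "x t2 = x t1"
  proof
    let ?t2 = "if t1 = 0 then T else t1"
    show "0 < ?t2" "?t2 \<le> T" "x ?t2 = x t1"
      using t1(1) per assms(2) by auto
  qed
  have "1 \<le> x t2"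
    using t1(2)[OF t] \<open>\<not> x t < 1\<close> t2 by simp
  have M: "0 \<le> M" using \<sigma>[of 0] by simp
  \<comment> \<open>If \<open>1 - x \<le> \<eta>\<close>, the right-hand side is at most
    \<open>M * \<eta> - lam * (1 - \<eta>)\<close>; this \<open>\<eta>\<close> makes that bound
    equal to \<open>- lam / 2\<close>.\<close>
  define \<eta> where "\<eta> = lam / 2 / (M + lam)"
  have "0 < \<eta>" using M assms(1) by (simp add: \<eta>_def)
  have "M + lam \<noteq> 0" using M assms(1) by simp
  then have "(M + lam) * \<eta> = lam / 2"
    unfolding \<eta>_def by (metis nonzero_mult_div_cancel_left times_divide_eq_right)
  then have \<eta>: "M * \<eta> + lam * \<eta> = lam / 2"
    by (simp add: distrib_right)
  obtain d where "0 < d" and d: "\<And>s. s \<in> {0..T} \<Longrightarrow> dist s t2 < d \<Longrightarrow> dist (x s) (x t2) < \<eta>"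
  proof -
    have "t2 \<in> {0..T}" using t2 by simp
    then show thesis
      using cont[unfolded continuous_on_iff] \<open>0 < \<eta>\<close> that by blast
  qed
  \<comment> \<open>A point to the left of \<open>t2\<close> within the continuity radius; the
    maximum with 0 keeps it in the period.\<close>
  define s where "s = max 0 (t2 - d / 2)"
  have s: "0 \<le> s" "s < t2" "t2 - s < d"
    using t2 \<open>0 < d\<close> by (auto simp: s_def)
  have "x t2 - x s \<le> - (lam / 2) * (t2 - s)"
  proof (rule has_integral_le)
    show "((\<lambda>t. \<sigma> t * (1 - x t) - lam * x t) has_integral (x t2 - x s)) {s..t2}"
      using caratheodory_solution_has_integral[OF sol, of s t2] s by simp
    show "((\<lambda>t. - (lam / 2)) has_integral - (lam / 2) * (t2 - s)) {s..t2}"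
      using has_integral_const_real[of "- (lam / 2)" s t2] s by (simp add: mult.commute)
    fix r assume r: "r \<in> {s..t2}"
    then have "dist (x r) (x t2) < \<eta>"
      using s t2 by (intro d) (auto simp: dist_real_def)
    then have "1 - x r \<le> \<eta>"
      using \<open>1 \<le> x t2\<close> by (simp add: dist_real_def)
    have "0 \<le> r" using r s by simp
    have "\<sigma> r * (1 - x r) \<le> \<sigma> r * \<eta>"
      using \<open>1 - x r \<le> \<eta>\<close> \<sigma>[OF \<open>0 \<le> r\<close>] by (intro mult_left_mono) auto
    also have "\<dots> \<le> M * \<eta>"
      using \<open>0 < \<eta>\<close> \<sigma>[OF \<open>0 \<le> r\<close>] by (intro mult_right_mono) auto
    finally have "\<sigma> r * (1 - x r) \<le> M * \<eta>" .
    moreover have "lam * (1 - \<eta>) \<le> lam * x r"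
      using \<open>1 - x r \<le> \<eta>\<close> assms(1) by (intro mult_left_mono) auto
    ultimately show "\<sigma> r * (1 - x r) - lam * x r \<le> - (lam / 2)"
      using \<eta> by (simp add: algebra_simps)
  qed
  moreover have "0 < (lam / 2) * (t2 - s)"
    using assms(1) s by simp
  moreover have "x s \<le> x t2"
    using t1(2)[of s] s t2 by simp
  ultimately show False by linarith
qed

text \<open>By compactness \<open>1 - x\<close> has a positive minimum \<open>m\<close>, so
  \<open>ln\<close> is Lipschitz on its range and \<open>- ln (1 - x)\<close> is absolutely
  continuous. Its derivative integrates to a difference of boundary values, which cancel by
  periodicity.\<close>

lemma periodic_x_log_balance:
  fixes x \<sigma> :: "real \<Rightarrow> real"
  assumes "0 < lam" "0 < T"
    and sol: "caratheodory_solution (\<lambda>t u. \<sigma> t * (1 - u) - lam * u) x"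
    and per: "x T = x 0"
    and \<sigma>: "\<And>t. 0 \<le> t \<Longrightarrow> 0 \<le> \<sigma> t \<and> \<sigma> t \<le> M"
  shows "((\<lambda>t. \<sigma> t - lam * (x t / (1 - x t))) has_integral 0) {0..T}"
proof -
  have less1: "x t < 1" if "t \<in> {0..T}" for t
    using periodic_x_less_one[OF assms that] .
  have cont: "continuous_on {0..T} x"
    using sol by (rule caratheodory_solution_continuous_on)
  obtain t1 where t1: "t1 \<in> {0..T}" "\<And>s. s \<in> {0..T} \<Longrightarrow> x s \<le> x t1"
    using continuous_attains_sup[OF _ _ cont] assms(2) by fastforce
  define m where "m = 1 - x t1"
  have "0 < m" using less1[OF t1(1)] by (simp add: m_def)
  obtain N where N: "negligible N"
      "\<And>t. 0 \<le> t \<Longrightarrow> t \<notin> N \<Longrightarrow>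
        (x has_vector_derivative \<sigma> t * (1 - x t) - lam * x t) (at t within {0..})"
    using caratheodory_solution_deriv[OF sol] by metis
  let ?g = "\<lambda>y :: real. - ln (1 - y)"
  have "((\<lambda>t. \<sigma> t - lam * (x t / (1 - x t))) has_integral (?g (x T) - ?g (x 0))) {0..T}"
  proof (rule absolutely_continuous_on_has_integral[OF _ _ N(1)])
    have "absolutely_continuous_on 0 T x"
      using sol assms(2) by (simp add: caratheodory_solution_def)
    moreover have "(1 / m)-lipschitz_on (x ` {0..T}) ?g"
    proof (rule lipschitz_onI)
      fix u v assume "u \<in> x ` {0..T}" "v \<in> x ` {0..T}"
      then have "1 - u \<in> {m..}" "1 - v \<in> {m..}"
        using t1(2) by (auto simp: m_def)
      then have "dist (ln (1 - u)) (ln (1 - v)) \<le> 1 / m * dist (1 - u) (1 - v)"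
        by (rule lipschitz_onD[OF lipschitz_on_ln[OF \<open>0 < m\<close>]])
      then show "dist (?g u) (?g v) \<le> 1 / m * dist u v"
        by (simp add: dist_real_def abs_minus_commute)
    qed (use \<open>0 < m\<close> in simp)
    ultimately show "absolutely_continuous_on 0 T (\<lambda>t. ?g (x t))"
      by (rule absolutely_continuous_on_Lipschitz_compose)
    fix t assume t: "t \<in> {0..T} - N"
    then have pos: "0 < 1 - x t" using less1[of t] by simp
    have "(x has_vector_derivative \<sigma> t * (1 - x t) - lam * x t) (at t within {0..T})"
      using t by (intro has_vector_derivative_within_subset[OF N(2)]) auto
    then have "(x has_real_derivative \<sigma> t * (1 - x t) - lam * x t) (at t within {0..T})"
      by (simp add: has_real_derivative_iff_has_vector_derivative)
    then have "((\<lambda>t. ?g (x t)) has_real_derivative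
        (\<sigma> t * (1 - x t) - lam * x t) / (1 - x t)) (at t within {0..T})"
      using pos by (auto intro!: derivative_eq_intros simp: field_simps)
    moreover have "(\<sigma> t * (1 - x t) - lam * x t) / (1 - x t) = \<sigma> t - lam * (x t / (1 - x t))"
      using pos by (simp add: diff_divide_distrib)
    ultimately show "((\<lambda>t. ?g (x t)) has_vector_derivative \<sigma> t - lam * (x t / (1 - x t)))
        (at t within {0..T})"
      by (simp add: has_real_derivative_iff_has_vector_derivative)
  qed (use assms(2) in simp)
  then show ?thesis using per by simp
qed

text \<open>The right-hand side is the tangent of the convex function \<open>lam * y / (1 - y)\<close> at the
  equilibrium \<open>s / (lam + s)\<close>.\<close>

lemma occupancy_tangent_le:
  fixes y s lam :: real
  assumes "0 < lam" "0 < s" "y < 1"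
  shows "s + (lam + s)^2 / lam * (y - s / (lam + s)) \<le> lam * (y / (1 - y))"
proof -
  \<comment> \<open>The gap is a square over a positive denominator, and the square vanishes exactly
    at the point of tangency.\<close>
  have "lam * (y / (1 - y)) - (s + (lam + s)^2 / lam * (y - s / (lam + s)))
      = ((lam + s) * y - s)^2 / (lam * (1 - y))"
    using assms by (simp add: divide_simps power2_eq_square) (simp add: algebra_simps)
  also have "\<dots> \<ge> 0" using assms by simp
  finally show ?thesis by simp
qed

text \<open>Jensen's inequality by way of a tangent: both \<open>\<sigma>\<close> and
  \<open>lam * x / (1 - x)\<close> have mean \<open>s\<close>, which is also the tangent's value at
  the equilibrium. Integrating the tangent bound therefore leaves the positive slope times the mean
  deviation of \<open>x\<close>, at most 0.\<close>

lemma periodic_x_mean_le: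
  fixes x \<sigma> :: "real \<Rightarrow> real"
  assumes "0 < lam" "0 < T" "0 < s"
    and sol: "caratheodory_solution (\<lambda>t u. \<sigma> t * (1 - u) - lam * u) x"
    and per: "x T = x 0"
    and \<sigma>: "\<And>t. 0 \<le> t \<Longrightarrow> 0 \<le> \<sigma> t \<and> \<sigma> t \<le> M"
    and mean: "(\<sigma> has_integral (T * s)) {0..T}"
  shows "integral {0..T} x \<le> T * (s / (lam + s))"
proof -
  let ?k = "(lam + s)^2 / lam"
  have "x integrable_on {0..T}"
    using caratheodory_solution_continuous_on[OF sol] by (rule integrable_continuous_real)
  then have "((\<lambda>t. x t - s / (lam + s)) has_integral (integral {0..T} x - T * (s / (lam + s)))) {0..T}"
    using has_integral_const_real[of "s / (lam + s)" 0 T] assms(2)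
    by (intro has_integral_diff integrable_integral) auto
  from has_integral_mult_right[OF this, of ?k] has_integral_const_real[of s 0 T] assms(2)
  have lower: "((\<lambda>t. s + ?k * (x t - s / (lam + s))) has_integral
      (T * s + ?k * (integral {0..T} x - T * (s / (lam + s))))) {0..T}"
    by (intro has_integral_add) auto
  \<comment> \<open>Subtracting the balance from \<open>\<sigma>\<close> yields both the
    integrability and the integral of \<open>lam * x / (1 - x)\<close>.\<close>
  have "((\<lambda>t. \<sigma> t - (\<sigma> t - lam * (x t / (1 - x t)))) has_integral (T * s - 0)) {0..T}"
    using mean periodic_x_log_balance[OF assms(1,2) sol per \<sigma>] by (rule has_integral_diff)
  then have "((\<lambda>t. lam * (x t / (1 - x t))) has_integral (T * s)) {0..T}"
    by simp
  from lower this have "T * s + ?k * (integral {0..T} x - T * (s / (lam + s))) \<le> T * s"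
  proof (rule has_integral_le)
    fix t assume "t \<in> {0..T}"
    then have "x t < 1"
      using periodic_x_less_one[OF assms(1,2) sol per \<sigma>] by blast
    then show "s + ?k * (x t - s / (lam + s)) \<le> lam * (x t / (1 - x t))"
      using assms(1,3) by (intro occupancy_tangent_le)
  qed
  then have "?k * (integral {0..T} x - T * (s / (lam + s))) \<le> 0"
    by simp
  moreover have "0 < ?k" using assms(1,3) by simp
  ultimately have "integral {0..T} x - T * (s / (lam + s)) \<le> 0"
    by (metis mult_pos_pos not_le)
  then show ?thesis by simp
qed

section \<open>The linear subsystem and the mean of the output\<close>

text \<open>Since \<open>z\<close> returns to its initial value, the right-hand side integrates to
  0; this gives \<open>A *v Z + (lam * X) *\<^sub>R b = 0\<close>, which is solved for
  \<open>Z\<close> by inverting \<open>- A\<close>.\<close>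

lemma periodic_z_mean:
  fixes A :: "real^'n^'n" and z :: "real \<Rightarrow> real^'n"
  assumes "hurwitz A" "0 \<le> T"
    and sol: "z_trajectory lam A b x z"
    and per: "z T = z 0"
    and x: "x integrable_on {0..T}"
  shows "integral {0..T} (\<lambda>t. c \<bullet> z t) = lam * integral {0..T} x * transfer_function A b c 0"
proof -
  define Z where "Z = integral {0..T} z"
  define X where "X = integral {0..T} x"
  have sol: "caratheodory_solution (\<lambda>t u. A *v u + (lam * x t) *\<^sub>R b) z"
    using sol by (simp add: z_trajectory_def)
  have Z: "(z has_integral Z) {0..T}"
    unfolding Z_def using caratheodory_solution_continuous_on[OF sol]
    by (intro integrable_integral integrable_continuous_real)
  have X: "(x has_integral X) {0..T}"
    unfolding X_def using x by (rule integrable_integral)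
  have "((\<lambda>t. A *v z t) has_integral (A *v Z)) {0..T}"
    using has_integral_linear[OF Z, of "(*v) A"] by (simp add: o_def)
  moreover have "((\<lambda>t. (lam * x t) *\<^sub>R b) has_integral ((lam * X) *\<^sub>R b)) {0..T}"
    by (intro has_integral_scaleR_left has_integral_mult_right X)
  ultimately have "((\<lambda>t. A *v z t + (lam * x t) *\<^sub>R b) has_integral (A *v Z + (lam * X) *\<^sub>R b)) {0..T}"
    by (rule has_integral_add)
  moreover have "((\<lambda>t. A *v z t + (lam * x t) *\<^sub>R b) has_integral 0) {0..T}"
    using caratheodory_solution_has_integral[OF sol, of 0 T] assms(2) per by simp
  ultimately have balance: "A *v Z + (lam * X) *\<^sub>R b = 0"
    by (rule has_integral_unique)
  have "(mat 0 - A) *v Z = - (A *v Z)"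
    by (simp only: matrix_vector_mult_diff_rdistrib mat_0 matrix_vector_mult_0) simp
  then have "(mat 0 - A) *v Z = (lam * X) *\<^sub>R b"
    using balance by (metis minus_unique)
  then have "Z = (lam * X) *\<^sub>R (matrix_inv (mat 0 - A) *v b)"
    using matrix_inv_solves[OF hurwitz_imp_invertible[OF assms(1), of 0]]
    by (simp add: matrix_vector_mult_scaleR)
  moreover have "integral {0..T} (\<lambda>t. c \<bullet> z t) = c \<bullet> Z"
    using has_integral_linear[OF Z bounded_linear_inner_right, of c]
    by (simp add: o_def integral_unique)
  ultimately show ?thesis
    by (simp add: transfer_function_def X_def)
qed

theorem theorem10:
  fixes lam T \<sigma>1 \<sigma>bar \<sigma>2 :: real
    and A :: "real^'n^'n" and b c :: "real^'n"
    and \<sigma> x :: "real \<Rightarrow> real" and z :: "real \<Rightarrow> real^'n"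
  assumes "0 < lam" and "0 < T"
    and "0 < \<sigma>1" and "\<sigma>1 < \<sigma>bar" and "\<sigma>bar < \<sigma>2"
    and "(\<sigma>1 + \<sigma>2) / 2 = \<sigma>bar"
    and "hurwitz A" and "metzler A"
    and "\<forall>i. 0 \<le> b $ i" and "\<forall>i. 0 \<le> c $ i"
    and "\<sigma> \<in> admissible_inflows lam T \<sigma>1 \<sigma>bar \<sigma>2"
    and "periodic_trajectory lam T A b \<sigma> x z"
  shows "(1 / T) * integral {0..T} (\<lambda>t. c \<bullet> z t)
           \<le> lam * \<sigma>bar / (lam + \<sigma>bar) * transfer_function A b c 0"
proof -
  have sol: "caratheodory_solution (\<lambda>t u. \<sigma> t * (1 - u) - lam * u) x"
    and z: "z_trajectory lam A b x z"
    and per: "x (0 + T) = x 0" "z (0 + T) = z 0"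
    using assms(12)
    by (simp_all add: periodic_trajectory_def periodic_x_def x_trajectory_def periodic_from_0_def
        del: add_0)
  have \<sigma>: "0 \<le> \<sigma> t \<and> \<sigma> t \<le> \<sigma>2" if "0 \<le> t" for t
  proof -
    have "\<sigma> t \<in> {\<sigma>1, \<sigma>bar, \<sigma>2}"
      using assms(11) that by (simp add: admissible_inflows_def)
    then show ?thesis using assms(3-5) by auto
  qed
  have mean: "integral {0..T} \<sigma> = T * \<sigma>bar"
    using assms(2,11) by (simp add: admissible_inflows_def field_simps)
  \<comment> \<open>a non-integrable function has integral 0\<close>
  moreover have "T * \<sigma>bar \<noteq> 0" using assms(2-4) by simp
  ultimately have "(\<sigma> has_integral (T * \<sigma>bar)) {0..T}"
    by (metis has_integral_iff not_integrable_integral)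
  then have X: "integral {0..T} x \<le> T * (\<sigma>bar / (lam + \<sigma>bar))"
    using periodic_x_mean_le[OF assms(1,2) _ sol _ \<sigma>] per assms(3,4) by simp
  have "integral {0..T} (\<lambda>t. c \<bullet> z t) = lam * integral {0..T} x * transfer_function A b c 0"
    using assms(2,7) z per
    by (intro periodic_z_mean integrable_continuous_real caratheodory_solution_continuous_on[OF sol]) auto
  \<comment> \<open>The bound on the mean of \<open>x\<close> passes to the output because
    \<open>transfer_function A b c 0\<close> is nonnegative.\<close>
  also have "\<dots> \<le> lam * (T * (\<sigma>bar / (lam + \<sigma>bar))) * transfer_function A b c 0"
    using X assms(1) transfer_function_zero_nonneg[OF assms(7-10)]
    by (intro mult_right_mono mult_left_mono) auto
  finally have "(1 / T) * integral {0..T} (\<lambda>t. c \<bullet> z t)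
      \<le> (1 / T) * (lam * (T * (\<sigma>bar / (lam + \<sigma>bar))) * transfer_function A b c 0)"
    using assms(2) by (intro mult_left_mono) auto
  then show ?thesis
    using assms(2) by simp
qed

end
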